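(* Let $(K,L,q,1,X,\cdot,h,\theta)$ be a quadrangular algebra over a field $K$ with $\operatorname{char}(K)\neq2,3$. Then $X$ is a Freudenthal triple system with triple product $$xyz:=\tfrac12\bigl(x(h(y,z)+h(z,y))+y(h(x,z)+h(z,x))+z(h(x,y)+h(y,x))\bigr)$$ and skew symmetric bilinear form $\langle x,y\rangle:=g(x,y)$, for all $x,y,z\in X$. This Freudenthal triple system is simple and not reduced. Furthermore, $xyz$ is the linearization of $x\mapsto x\pi(x)$, and $\langle x,yzw\rangle$ is the linearization of $x\mapsto-\frac12q(\pi(x))$. In particular, $xxx=6x\pi(x)$ and $\langle x,xxx\rangle=-12q(\pi(x))$ for all $x\in X$.
   Context: **Quadrangular algebras.** A quadrangular algebra of characteristic different from 2 is an 8-tuple $(K,L,q,1,X,\cdot,h,\theta)$ where $K$ is a commutative field with $\operatorname{char}K\ne2$, $L$ is a $K$-vector space, $q:L\to K$ is an anisotropic quadratic form, $1\in L$ satisfies $q(1)=1$, $X$ is a nonzero $K$-vector space, $\cdot:X\times L\to X$, $(a,v)\mapsto av$, $h:X\times X\to L$ and $\theta:X\times L\to L$ are maps such that, with $f(u,v)=q(u+v)-q(u)-q(v)$, $v^\sigma=f(1,v)1-v$, $v^{-1}=v^\sigma/q(v)$ for $v\neq 0$: (A1) $\cdot$ is $K$-bilinear; (A2) $a\cdot1=a$; (A3) $(av)v^{-1}=a$ for $v\ne0$; (B1) $h$ is $K$-bilinear; (B2) $h(a,bv)=h(b,av)+f(h(a,b),1)v$; (B3) $f(h(av,b),1)=f(h(a,b),v)$;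 (C) $\theta(a,v)=\frac12h(a,av)$; (D1) with $\pi(a):=\theta(a,1)$, $a\theta(a,v)=(a\pi(a))v$; (D2) $\pi(a)\in K1$ if and only if $a=0$; for all $a,b\in X$, $v\in L$. Put $g(a,b)=\frac12f(h(a,b),1)$. **Freudenthal triple systems.** Over a field $K$ of characteristic not 2 or 3, a Freudenthal triple system is a $K$-vector space $V$ with a symmetric trilinear product $V^3\to V$, $(x,y,z)\mapsto xyz$, and a skew symmetric bilinear form $\langle\cdot,\cdot\rangle:V\times V\to K$ such that (i) $(x,y,z,w)\mapsto\langle x,yzw\rangle$ is a nonzero symmetric 4-linear form; (ii) $(xxx)xy=\langle y,x\rangle xxx+\langle y,xxx\rangle x$ for all $x,y\in V$. An element $u\in V\setminus\{0\}$ is strictly regular if $uVV\subseteq Ku$; $V$ is reduced if it contains a strictly regular element; $V$ is simple if there is no subspace $I\ne0,V$ with $IVV\subseteq I$. **Linearization.** The linearization of a homogeneous map $A$ of degree $n$ is the symmetric $n$-linear map $B$ with $B(x,\dots,x)=n!\,A(x)$. *)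

theory Defs
  imports Complex_Main "HOL-Combinatorics.Permutations"
begin

section \<open>Multilinear maps and linearization\<close>

definition bilinear_map ::
  "('k::field \<Rightarrow> 'u::ab_group_add \<Rightarrow> 'u) \<Rightarrow> ('k \<Rightarrow> 'v::ab_group_add \<Rightarrow> 'v) \<Rightarrow>
   ('k \<Rightarrow> 'w::ab_group_add \<Rightarrow> 'w) \<Rightarrow> ('u \<Rightarrow> 'v \<Rightarrow> 'w) \<Rightarrow> bool"
  where "bilinear_map s1 s2 s3 b \<longleftrightarrow>
    (\<forall>v. Vector_Spaces.linear s1 s3 (\<lambda>u. b u v)) \<and> (\<forall>u. Vector_Spaces.linear s2 s3 (b u))"

text \<open>An \<open>n\<close>-ary map takes a tuple \<open>x :: nat \<Rightarrow> 'v\<close> and may only look at \<open>x 0, \<dots>, x (n - 1)\<close>.\<close>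

definition symmetric_multilinear ::
  "nat \<Rightarrow> ('k::field \<Rightarrow> 'v::ab_group_add \<Rightarrow> 'v) \<Rightarrow> ('k \<Rightarrow> 'w::ab_group_add \<Rightarrow> 'w) \<Rightarrow>
   ((nat \<Rightarrow> 'v) \<Rightarrow> 'w) \<Rightarrow> bool"
  where "symmetric_multilinear n s t B \<longleftrightarrow>
    (\<forall>x y. (\<forall>i<n. x i = y i) \<longrightarrow> B x = B y) \<and>
    (\<forall>i<n. \<forall>x. Vector_Spaces.linear s t (\<lambda>v. B (x(i := v)))) \<and>
    (\<forall>p x. p permutes {..<n} \<longrightarrow> B (x \<circ> p) = B x)"

definition homogeneous_map ::
  "nat \<Rightarrow> ('k::field \<Rightarrow> 'v \<Rightarrow> 'v) \<Rightarrow> ('k \<Rightarrow> 'w \<Rightarrow> 'w) \<Rightarrow> ('v \<Rightarrow> 'w) \<Rightarrow> bool"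
  where "homogeneous_map n s t A \<longleftrightarrow> (\<forall>c v. A (s c v) = t (c ^ n) (A v))"

text \<open>The last conjunct expresses that \<open>B\<close> is \<^emph>\<open>the\<close> linearization of \<open>A\<close>.\<close>

definition is_linearization ::
  "nat \<Rightarrow> ('k::field \<Rightarrow> 'v::ab_group_add \<Rightarrow> 'v) \<Rightarrow> ('k \<Rightarrow> 'w::ab_group_add \<Rightarrow> 'w) \<Rightarrow>
   ('v \<Rightarrow> 'w) \<Rightarrow> ((nat \<Rightarrow> 'v) \<Rightarrow> 'w) \<Rightarrow> bool"
  where "is_linearization n s t A B \<longleftrightarrow>
    homogeneous_map n s t A \<and>
    symmetric_multilinear n s t B \<and> (\<forall>v. B (\<lambda>_. v) = t (of_nat (fact n)) (A v)) \<and>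
    (\<forall>B'. symmetric_multilinear n s t B' \<and> (\<forall>v. B' (\<lambda>_. v) = t (of_nat (fact n)) (A v))
       \<longrightarrow> B' = B)"

section \<open>Quadrangular algebras\<close>

definition polar :: "('l::ab_group_add \<Rightarrow> 'k::field) \<Rightarrow> 'l \<Rightarrow> 'l \<Rightarrow> 'k"
  where "polar q u v = q (u + v) - q u - q v"

definition quadratic_form :: "('k::field \<Rightarrow> 'l::ab_group_add \<Rightarrow> 'l) \<Rightarrow> ('l \<Rightarrow> 'k) \<Rightarrow> bool"
  where "quadratic_form s q \<longleftrightarrow>
    homogeneous_map 2 s (*) q \<and> bilinear_map s s (*) (polar q)"

definition anisotropic :: "('l::zero \<Rightarrow> 'k::zero) \<Rightarrow> bool"
  where "anisotropic q \<longleftrightarrow> (\<forall>v. q v = 0 \<longrightarrow> v = 0)"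

definition qsigma ::
  "('k::field \<Rightarrow> 'l::ab_group_add \<Rightarrow> 'l) \<Rightarrow> ('l \<Rightarrow> 'k) \<Rightarrow> 'l \<Rightarrow> 'l \<Rightarrow> 'l"
  where "qsigma s q e v = s (polar q e v) e - v"

definition qinv ::
  "('k::field \<Rightarrow> 'l::ab_group_add \<Rightarrow> 'l) \<Rightarrow> ('l \<Rightarrow> 'k) \<Rightarrow> 'l \<Rightarrow> 'l \<Rightarrow> 'l"
  where "qinv s q e v = s (inverse (q v)) (qsigma s q e v)"

text \<open>The base point \<open>1 \<in> L\<close> is written \<open>e\<close>; the product \<open>av\<close> is \<open>act a v\<close>; and \<open>\<pi>(a)\<close> is
  \<open>\<theta> a e\<close>.\<close>

locale quadrangular_algebra =
  L: vector_space scaleL + X: vector_space scaleX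
  for scaleL :: "'k::field \<Rightarrow> 'l::ab_group_add \<Rightarrow> 'l"
    and scaleX :: "'k \<Rightarrow> 'x::ab_group_add \<Rightarrow> 'x" +
  fixes q :: "'l \<Rightarrow> 'k"
    and e :: 'l
    and act :: "'x \<Rightarrow> 'l \<Rightarrow> 'x"
    and h :: "'x \<Rightarrow> 'x \<Rightarrow> 'l"
    and \<theta> :: "'x \<Rightarrow> 'l \<Rightarrow> 'l"
  assumes char_not_2: "CHAR('k) \<noteq> 2"
    and quadratic_form: "quadratic_form scaleL q"
    and anisotropic: "anisotropic q"
    and q_one: "q e = 1"
    and X_nonzero: "\<exists>a::'x. a \<noteq> 0"
    and A1: "bilinear_map scaleX scaleL scaleX act"
    and A2: "act a e = a"
    and A3: "v \<noteq> 0 \<Longrightarrow> act (act a v) (qinv scaleL q e v) = a"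
    and B1: "bilinear_map scaleX scaleX scaleL h"
    and B2: "h a (act b v) = h b (act a v) + scaleL (polar q (h a b) e) v"
    and B3: "polar q (h (act a v) b) e = polar q (h a b) v"
    and C: "\<theta> a v = scaleL (1/2) (h a (act a v))"
    and D1: "act a (\<theta> a v) = act (act a (\<theta> a e)) v"
    and D2: "\<theta> a e \<in> range (\<lambda>c. scaleL c e) \<longleftrightarrow> a = 0"

section \<open>Freudenthal triple systems\<close>

locale freudenthal_triple_system =
  vector_space scale
  for scale :: "'k::field \<Rightarrow> 'v::ab_group_add \<Rightarrow> 'v" +
  fixes tp :: "'v \<Rightarrow> 'v \<Rightarrow> 'v \<Rightarrow> 'v"
    and form :: "'v \<Rightarrow> 'v \<Rightarrow> 'k"
  assumes char_not_2: "CHAR('k) \<noteq> 2"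
    and char_not_3: "CHAR('k) \<noteq> 3"
    and tp_trilinear: "symmetric_multilinear 3 scale scale (\<lambda>x. tp (x 0) (x 1) (x 2))"
    and form_bilinear: "bilinear_map scale scale (*) form"
    and form_skew: "form x y = - form y x"
    and form4_linear: "symmetric_multilinear 4 scale (*) (\<lambda>x. form (x 0) (tp (x 1) (x 2) (x 3)))"
    and form4_nonzero: "\<exists>x y z w. form x (tp y z w) \<noteq> 0"
    and tp_identity:
      "tp (tp x x x) x y = scale (form y x) (tp x x x) + scale (form y (tp x x x)) x"
begin

definition strictly_regular :: "'v \<Rightarrow> bool"
  where "strictly_regular u \<longleftrightarrow> u \<noteq> 0 \<and> (\<forall>x y. tp u x y \<in> range (\<lambda>c. scale c u))"

definition reduced :: bool
  where "reduced \<longleftrightarrow> (\<exists>u. strictly_regular u)"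

definition simple :: bool
  where "simple \<longleftrightarrow>
    \<not> (\<exists>I. subspace I \<and> I \<noteq> {0} \<and> I \<noteq> UNIV \<and> (\<forall>u\<in>I. \<forall>x y. tp u x y \<in> I))"

end

end

theory Submission
  imports Defs
begin

text \<open>
  Write \<open>t(a, b) = h(a, b) + h(b, a)\<close>, so that
  \<open>xyz = 1/2 (x t(y, z) + y t(x, z) + z t(x, y))\<close>. By (B2), \<open>h(b, a)\<close> differs from \<open>h(a, b)\<close> by the multiple
  \<open>f(h(a, b), 1) = 2 g(a, b)\<close> of \<open>1\<close>; hence \<open>g\<close> is skew, and \<open>t(a, b) = 2 h(a, b) - 2 g(a, b) 1\<close> is
  symmetric and orthogonal to \<open>1\<close>. Together with (B3), in the form \<open>f(h(a, b), v) = 2 g(av, b)\<close>, this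
  gives (lemma \<open>g_tp\<close>)
  \<open>\<langle>w, xyz\<rangle> = - 1/8 (f(t(w, x), t(y, z)) + f(t(w, y), t(x, z)) + f(t(w, z), t(x, y)))\<close>,
  which is symmetric. As \<open>t(x, x) = 4 \<pi>(x)\<close>, the diagonal values are \<open>xxx = 6 x \<pi>(x)\<close> and
  \<open>\<langle>x, xxx\<rangle> = - 12 q(\<pi>(x))\<close>; the latter is nonzero for \<open>x \<noteq> 0\<close> by (D2) and anisotropy.

  Let \<open>p = \<pi>(x)\<close>. It has trace zero, so \<open>(ap)p = - q(p) a\<close>, and (D1) gives \<open>\<theta>(x, p) = - q(p) 1\<close> after
  cancelling \<open>x\<close>. By (C), \<open>h(x, xp) = 2 \<theta>(x, p)\<close> is a multiple of \<open>1\<close>, so \<open>t(x, xp) = 0\<close>.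
  Since \<open>\<theta>(x, _)\<close> is skew with respect to \<open>f\<close>, testing against all \<open>v \<in> L\<close> gives the key identity
  \<open>h(xp, y) = - \<theta>(x, h(x, y))\<close> (lemma \<open>h_act_pi\<close>). It implies \<open>\<pi>(xp) = q(p) p\<close> and, with (D1),
  \<open>x h(xp, y) = - (xp) h(x, y)\<close>. This and \<open>t(x, xp) = 0\<close> are what is needed for
  \<open>(xp) x y = \<langle>y, x\<rangle> xp + \<langle>y, xp\<rangle> x\<close> (lemma \<open>tp_act_pi\<close>), that is, for axiom (ii).

  For simplicity, let \<open>y\<close> belong to an ideal \<open>I\<close> and let \<open>\<langle>y, x\<rangle> \<noteq> 0\<close>. By axiom (ii), \<open>I\<close> contains a vector
  \<open>w = \<alpha> xp + \<beta> x\<close> with \<open>\<alpha> \<noteq> 0\<close>. It also contains \<open>www\<close>, a nonzero multiple of \<open>wp\<close>; and \<open>w\<close>, \<open>wp\<close> span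
  the plane of \<open>x\<close> and \<open>xp\<close>, so \<open>x \<in> I\<close> (lemma \<open>mem_ideal\<close>). Thus if \<open>I\<close> is proper, every vector of \<open>I\<close> is
  orthogonal to everything outside \<open>I\<close>, hence to all of \<open>X\<close>, and so is zero because of its cube. Strictly
  regular elements are excluded by \<open>uuu = 6 u \<pi>(u)\<close> and (D2).

  Uniqueness of the linearizations reduces to the fact that a symmetric trilinear or quadrilinear map
  that vanishes on the diagonal is zero in characteristic other than 2 and 3.
\<close>

section \<open>Symmetric multilinear maps\<close>

text \<open>Invariance under transpositions suffices, since they generate the symmetric group.\<close>

lemma symmetric_multilinearI:
  assumes depends: "\<And>x y. (\<And>i. i < n \<Longrightarrow> x i = y i) \<Longrightarrow> B x = B y"
    and lin: "\<And>i x. i < n \<Longrightarrow> Vector_Spaces.linear s t (\<lambda>v. B (x(i := v)))"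
    and swap: "\<And>i j x. i < n \<Longrightarrow> j < n \<Longrightarrow> i \<noteq> j \<Longrightarrow> B (x \<circ> Transposition.transpose i j) = B x"
  shows "symmetric_multilinear n s t B"
proof -
  have "\<forall>x. B (x \<circ> p) = B x" if "p permutes {..<n}" for p
    using that finite_lessThan
  proof (induction rule: permutes_induct)
    case (swap i j p)
    have "B ((x \<circ> Transposition.transpose i j) \<circ> p) = B x" for x
    proof -
      have "B ((x \<circ> Transposition.transpose i j) \<circ> p) = B (x \<circ> Transposition.transpose i j)"
        using swap.IH by blast
      also have "\<dots> = B x"
        using swap.hyps by (intro assms(3)) simp_all
      finally show ?thesis .
    qed
    then show ?case
      by (simp only: comp_assoc simp_thms)
  qed simp
  then show ?thesis
    unfolding symmetric_multilinear_def using depends lin by blast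
qed

lemma symmetric_multilinear_diff:
  assumes "symmetric_multilinear n s t B" and "symmetric_multilinear n s t B'"
  shows "symmetric_multilinear n s t (\<lambda>x. B x - B' x)"
proof -
  have "Vector_Spaces.linear s t (\<lambda>v. B (x(i := v)) - B' (x(i := v)))" if "i < n" for i x
  proof -
    have lin: "Vector_Spaces.linear s t (\<lambda>v. B (x(i := v)))"
      "Vector_Spaces.linear s t (\<lambda>v. B' (x(i := v)))"
      using assms that by (simp_all add: symmetric_multilinear_def)
    then interpret vector_space_pair s t
      by (simp add: Vector_Spaces.linear_iff vector_space_pair_def)
    show ?thesis
      using lin by (rule linear_compose_sub)
  qed
  moreover have "B x - B' x = B y - B' y" if "\<forall>i<n. x i = y i" for x y
    using assms that unfolding symmetric_multilinear_def by metis
  ultimately show ?thesis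
    using assms by (simp add: symmetric_multilinear_def)
qed

text \<open>A list of length \<open>n\<close> is a convenient \<open>n\<close>-tuple: its \<open>nth\<close> function agrees with the tuple on
  the relevant indices, and permuting the arguments preserves the multiset.\<close>

lemma symmetric_multilinear_mset_cong:
  assumes "symmetric_multilinear n s t B" and "mset xs = mset ys" and "length xs = n"
  shows "B ((!) xs) = B ((!) ys)"
proof -
  obtain p where p: "p permutes {..<length ys}" "permute_list p ys = xs"
    using assms(2) by (rule mset_eq_permutation)
  have "length ys = n"
    using assms(2,3) mset_eq_length by metis
  then have "\<forall>i<n. xs ! i = ((!) ys \<circ> p) i"
    using p by (auto simp: permute_list_nth)
  then have "B ((!) xs) = B ((!) ys \<circ> p)"
    using assms(1) unfolding symmetric_multilinear_def by blast
  also have "\<dots> = B ((!) ys)"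
    using assms(1) p(1) \<open>length ys = n\<close> by (simp add: symmetric_multilinear_def)
  finally show ?thesis .
qed

lemma symmetric_multilinear_Cons_add:
  assumes "symmetric_multilinear n s t B" and "Suc (length xs) = n"
  shows "B ((!) ((u + v) # xs)) = B ((!) (u # xs)) + B ((!) (v # xs))"
proof -
  have upd: "(!) (w # xs) = ((!) (0 # xs))(0 := w)" for w
    by (auto simp: fun_eq_iff nth_Cons split: nat.split)
  have "Vector_Spaces.linear s t (\<lambda>w. B (((!) (0 # xs))(0 := w)))"
    using assms unfolding symmetric_multilinear_def by blast
  then show ?thesis
    by (simp only: upd[of u] upd[of v] upd[of "u + v"] Vector_Spaces.linear_iff)
qed

lemma symmetric_multilinear_minus:
  assumes "symmetric_multilinear n s t B" and "Suc (length xs) = n"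
  shows "B ((!) ((- v) # xs)) = - B ((!) (v # xs))"
  using symmetric_multilinear_Cons_add[OF assms, of 0 0]
    symmetric_multilinear_Cons_add[OF assms, of v "- v"]
  by (simp add: eq_neg_iff_add_eq_0 add.commute)

text \<open>The next two lemmas give uniqueness of the linearization. The cancellation hypotheses stand
  for "the characteristic is not 2 or 3". Comparing the expansions at \<open>v + w\<close> and \<open>v - w\<close> isolates
  the terms in which \<open>v\<close> has a given parity, without needing many scalars.\<close>

lemma symmetric_trilinear_eq_0:
  fixes B :: "(nat \<Rightarrow> 'v::ab_group_add) \<Rightarrow> 'w::ab_group_add"
  assumes B: "symmetric_multilinear 3 s t B" and diag: "\<And>v. B (\<lambda>_. v) = 0"
    and cancel2: "\<And>w::'w. w + w = 0 \<Longrightarrow> w = 0"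
    and cancel3: "\<And>w::'w. w + w + w = 0 \<Longrightarrow> w = 0"
  shows "B x = 0"
proof -
  define T where "T a b c = B ((!) [a, b, c])" for a b c
  have swap: "T a b c = T b a c" "T a b c = T a c b" for a b c
    unfolding T_def by (rule symmetric_multilinear_mset_cong[OF B]; simp)+
  have add1: "T (a + a') b c = T a b c + T a' b c" for a a' b c
    unfolding T_def by (rule symmetric_multilinear_Cons_add[OF B]) simp
  have neg1: "T (- a) b c = - T a b c" for a b c
    unfolding T_def by (rule symmetric_multilinear_minus[OF B]) simp
  have add: "T a (b + b') c = T a b c + T a b' c" "T a b (c + c') = T a b c + T a b c'"
    and neg: "T a (- b) c = - T a b c" "T a b (- c) = - T a b c" for a b b' c c'
    using add1 neg1 swap by metis+
  have depends: "B y = T (y 0) (y 1) (y 2)" for y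
  proof -
    have "y i = [y 0, y 1, y 2] ! i" if "i < 3" for i
      using that by (auto simp: less_Suc_eq numeral_3_eq_3 numeral_2_eq_2)
    then show ?thesis
      using B unfolding symmetric_multilinear_def T_def by blast
  qed
  have cube: "T v v v = 0" for v
    using diag[of v] by (simp add: depends)
  have square: "T v v w = 0" for v w
  proof -
    let ?a = "T v v w" and ?b = "T v w w"
    have expand: "(T v v u + T v v u + T v v u) + (T v u u + T v u u + T v u u) = 0" for u
      using cube[of "v + u"] cube[of v] cube[of u]
      by (simp add: add1 add swap ac_simps)
    have "?b + ?b + ?b = ?a + ?a + ?a"
      using expand[of "- w"] by (simp add: neg add_eq_0_iff algebra_simps)
    then have "(?a + ?a + ?a) + (?a + ?a + ?a) = 0"
      using expand[of w] by simp
    then show ?thesis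
      using cancel2 cancel3 by blast
  qed
  have "T a b c = 0" for a b c
  proof (rule cancel2)
    show "T a b c + T a b c = 0"
      using square[of "a + b" c] square[of a c] square[of b c] swap(1)[of b a c]
      by (simp add: add1 add)
  qed
  then show ?thesis
    by (simp add: depends)
qed

lemma symmetric_quadrilinear_eq_0:
  fixes B :: "(nat \<Rightarrow> 'v::ab_group_add) \<Rightarrow> 'w::ab_group_add"
  assumes B: "symmetric_multilinear 4 s t B" and diag: "\<And>v. B (\<lambda>_. v) = 0"
    and cancel2: "\<And>w::'w. w + w = 0 \<Longrightarrow> w = 0"
    and cancel3: "\<And>w::'w. w + w + w = 0 \<Longrightarrow> w = 0"
  shows "B x = 0"
proof -
  define T where "T a b c d = B ((!) [a, b, c, d])" for a b c d
  have swap: "T a b c d = T b a c d" "T a b c d = T a c b d" "T a b c d = T a b d c" for a b c d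
    unfolding T_def by (rule symmetric_multilinear_mset_cong[OF B]; simp)+
  have add1: "T (a + a') b c d = T a b c d + T a' b c d" for a a' b c d
    unfolding T_def by (rule symmetric_multilinear_Cons_add[OF B]) simp
  have neg1: "T (- a) b c d = - T a b c d" for a b c d
    unfolding T_def by (rule symmetric_multilinear_minus[OF B]) simp
  have add2: "T a (b + b') c d = T a b c d + T a b' c d"
    and neg2: "T a (- b) c d = - T a b c d" for a b b' c d
    using add1 neg1 swap(1) by metis+
  have add3: "T a b (c + c') d = T a b c d + T a b c' d"
    and neg3: "T a b (- c) d = - T a b c d" for a b c c' d
    using add2 neg2 swap(2) by metis+
  have add4: "T a b c (d + d') = T a b c d + T a b c d'"
    and neg4: "T a b c (- d) = - T a b c d" for a b c d d'
    using add3 neg3 swap(3) by metis+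
  have depends: "B y = T (y 0) (y 1) (y 2) (y 3)" for y
  proof -
    have "y i = [y 0, y 1, y 2, y 3] ! i" if "i < 4" for i
      using that by (auto simp: less_Suc_eq eval_nat_numeral)
    then show ?thesis
      using B unfolding symmetric_multilinear_def T_def by blast
  qed
  have fourth: "T v v v v = 0" for v
    using diag[of v] by (simp add: depends)
  have squares: "T v v w w = 0" for v w
  proof -
    let ?a = "T v v v w" and ?b = "T v v w w" and ?c = "T v w w w"
    let ?a4 = "?a + ?a + ?a + ?a" and ?b6 = "?b + ?b + ?b + ?b + ?b + ?b"
      and ?c4 = "?c + ?c + ?c + ?c"
    have expand: "(T v v u u + T v v u u + T v v u u + T v v u u + T v v u u + T v v u u) +
        ((T v v v u + T v v v u + T v v v u + T v v v u) +
         (T v u u u + T v u u u + T v u u u + T v u u u)) = 0" for u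
      using fourth[of "v + u"] fourth[of v] fourth[of u]
      by (simp add: add1 add2 add3 add4 swap ac_simps)
    have "?b6 = ?a4 + ?c4"
      using expand[of "- w"] by (simp add: neg2 neg3 neg4 add_eq_0_iff2 algebra_simps)
    then have "?b6 + ?b6 = 0"
      using expand[of w] by (simp only:)
    then have "?b6 = 0"
      by (rule cancel2)
    then have "(?b + ?b + ?b) + (?b + ?b + ?b) = 0"
      by (simp only: add.assoc)
    then show ?thesis
      using cancel2 cancel3 by blast
  qed
  have square: "T v v b c = 0" for v b c
  proof (rule cancel2)
    show "T v v b c + T v v b c = 0"
      using squares[of v "b + c"] squares[of v b] squares[of v c] swap(3)[of v v c b]
      by (simp add: add3 add4)
  qed
  have "T a b c d = 0" for a b c d
  proof (rule cancel2)
    show "T a b c d + T a b c d = 0"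
      using square[of "a + b" c d] square[of a c d] square[of b c d] swap(1)[of b a c d]
      by (simp add: add1 add2)
  qed
  then show ?thesis
    by (simp add: depends)
qed

lemma is_linearizationI:
  fixes s :: "'k::field \<Rightarrow> 'v::ab_group_add \<Rightarrow> 'v" and t :: "'k \<Rightarrow> 'w::ab_group_add \<Rightarrow> 'w"
  assumes "n = 3 \<or> n = 4" and two: "(2::'k) \<noteq> 0" and three: "(3::'k) \<noteq> 0"
    and "vector_space t" and "homogeneous_map n s t A"
    and B: "symmetric_multilinear n s t B"
    and diag: "\<And>v. B (\<lambda>_. v) = t (of_nat (fact n)) (A v)"
  shows "is_linearization n s t A B"
proof -
  interpret vector_space t by fact
  have cancel2: "w = 0" if "w + w = 0" for w :: 'w
  proof -
    have "t 2 w = w + w"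
      using scale_left_distrib[of 1 1 w] by simp
    then show ?thesis
      using that two by simp
  qed
  have cancel3: "w = 0" if "w + w + w = 0" for w :: 'w
  proof -
    have "t 3 w = w + w + w"
      using scale_left_distrib[of 1 1 w] scale_left_distrib[of 2 1 w] by simp
    then show ?thesis
      using that three by simp
  qed
  have "B' = B" if B': "symmetric_multilinear n s t B'"
    and diag': "\<And>v. B' (\<lambda>_. v) = t (of_nat (fact n)) (A v)" for B'
  proof
    fix x
    have D: "symmetric_multilinear n s t (\<lambda>x. B' x - B x)"
      using B' B by (rule symmetric_multilinear_diff)
    have diag0: "B' (\<lambda>_. v) - B (\<lambda>_. v) = 0" for v
      by (simp only: diag diag' diff_self)
    have "B' x - B x = 0"
      using assms(1)
    proof
      assume n: "n = 3"
      show ?thesis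
        using D[unfolded n] diag0 cancel2 cancel3
        by (rule symmetric_trilinear_eq_0[where B = "\<lambda>x. B' x - B x"])
    next
      assume n: "n = 4"
      show ?thesis
        using D[unfolded n] diag0 cancel2 cancel3
        by (rule symmetric_quadrilinear_eq_0[where B = "\<lambda>x. B' x - B x"])
    qed
    then show "B' x = B x" by simp
  qed
  then show ?thesis
    unfolding is_linearization_def using assms by blast
qed

section \<open>Notation and scalars in a quadrangular algebra\<close>

context quadrangular_algebra
begin

text \<open>The polar form of \<open>q\<close>.\<close>

abbreviation f :: "'l \<Rightarrow> 'l \<Rightarrow> 'k"
  where "f \<equiv> polar q"

text \<open>The involution \<open>\<sigma>\<close> of \<open>L\<close>.\<close>

abbreviation sigma :: "'l \<Rightarrow> 'l"
  where "sigma \<equiv> qsigma scaleL q e"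

abbreviation \<pi> :: "'x \<Rightarrow> 'l"
  where "\<pi> a \<equiv> \<theta> a e"

text \<open>The alternating form on \<open>X\<close>, half the trace of \<open>h\<close>, where the trace of \<open>v \<in> L\<close> is \<open>f v e\<close>.\<close>

definition g :: "'x \<Rightarrow> 'x \<Rightarrow> 'k"
  where "g a b = 1/2 * f (h a b) e"

text \<open>The unnormalized symmetrization of \<open>h\<close>. It is twice the component of \<open>h a b\<close> orthogonal to
  \<open>e\<close>, as \<open>f_hsym_e\<close> and \<open>hsym_alt\<close> show.\<close>

definition hsym :: "'x \<Rightarrow> 'x \<Rightarrow> 'l"
  where "hsym a b = h a b + h b a"

text \<open>The triple product on \<open>X\<close>, the full polarization of \<open>x \<mapsto> x \<pi>(x)\<close>.\<close>

definition tp :: "'x \<Rightarrow> 'x \<Rightarrow> 'x \<Rightarrow> 'x"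
  where "tp x y z = scaleX (1/2) (act x (hsym y z) + act y (hsym x z) + act z (hsym x y))"

lemma of_nat_nonzero: "of_nat n \<noteq> (0::'k)" if "n = 2 \<or> n = 3" and "CHAR('k) \<noteq> n"
proof
  assume "of_nat n = (0::'k)"
  then have dvd: "CHAR('k) dvd n"
    by (simp add: of_nat_eq_0_iff_char_dvd)
  have "CHAR('k) \<noteq> 0"
    using dvd that(1) by (intro notI) auto
  moreover have "CHAR('k) \<le> n"
    using dvd that(1) by (auto dest: dvd_imp_le)
  ultimately have "n = 3 \<and> CHAR('k) = 2"
    using that CHAR_not_1[where ?'a = 'k] by arith
  then show False
    using dvd by simp
qed

lemma two_nonzero: "(2::'k) \<noteq> 0"
  using of_nat_nonzero[of 2] char_not_2 by simp

lemma three_nonzero: "(3::'k) \<noteq> 0" if "CHAR('k) \<noteq> 3"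
  using of_nat_nonzero[of 3] that by simp

lemma four_nonzero: "(4::'k) \<noteq> 0"
  using two_nonzero mult_eq_0_iff[of "2::'k" 2] by simp

section \<open>Linearity of the structure maps\<close>

lemma act_add_left: "act (a + b) v = act a v + act b v"
  and act_scale_left: "act (scaleX c a) v = scaleX c (act a v)"
  and act_add_right: "act a (v + w) = act a v + act a w"
  and act_scale_right: "act a (scaleL c v) = scaleX c (act a v)"
  using A1 by (auto simp: bilinear_map_def Vector_Spaces.linear_iff)

lemma h_add_left: "h (a + b) c = h a c + h b c"
  and h_scale_left: "h (scaleX r a) c = scaleL r (h a c)"
  and h_add_right: "h a (b + c) = h a b + h a c"
  and h_scale_right: "h a (scaleX r c) = scaleL r (h a c)"
  using B1 by (auto simp: bilinear_map_def Vector_Spaces.linear_iff)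

lemma f_add_left: "f (u + v) w = f u w + f v w"
  and f_scale_left: "f (scaleL r u) w = r * f u w"
  and f_add_right: "f u (v + w) = f u v + f u w"
  and f_scale_right: "f u (scaleL r w) = r * f u w"
  using quadratic_form by (auto simp: quadratic_form_def bilinear_map_def Vector_Spaces.linear_iff)

lemmas bilinear_simps =
  act_add_left act_scale_left act_add_right act_scale_right
  h_add_left h_scale_left h_add_right h_scale_right
  f_add_left f_scale_left f_add_right f_scale_right

lemma act_0_left [simp]: "act 0 v = 0" and act_0_right [simp]: "act a 0 = 0"
  using act_scale_left[of 0 0 v] act_scale_right[of a 0 0] by simp_all

lemma h_0_left [simp]: "h 0 b = 0" and h_0_right [simp]: "h a 0 = 0"
  using h_scale_left[of 0 0 b] h_scale_right[of a 0 0] by simp_all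

lemma f_0_left [simp]: "f 0 v = 0" and f_0_right [simp]: "f v 0 = 0"
  using f_scale_left[of 0 0 v] f_scale_right[of v 0 0] by simp_all

lemma act_minus_right: "act a (- v) = - act a v"
  using act_scale_right[of a "- 1" v] by simp

lemma act_diff_right: "act a (v - w) = act a v - act a w"
  using act_add_right[of a v "- w"] by (simp add: act_minus_right)

lemma h_minus_right: "h a (- b) = - h a b"
  using h_scale_right[of a "- 1" b] by simp

lemma f_minus_left: "f (- u) v = - f u v"
  using f_scale_left[of "- 1" u v] by simp

lemma f_diff_left: "f (u - v) w = f u w - f v w"
  using f_add_left[of u "- v" w] by (simp add: f_minus_left)

lemma q_scale: "q (scaleL c v) = c\<^sup>2 * q v"
  using quadratic_form by (simp add: quadratic_form_def homogeneous_map_def)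

lemma f_commute: "f u v = f v u"
  by (simp add: polar_def add.commute)

lemma f_self: "f v v = 2 * q v"
proof -
  have "q (v + v) = q (scaleL 2 v)"
    using L.scale_left_distrib[of 1 1 v] by simp
  then show ?thesis
    by (simp add: polar_def q_scale power2_eq_square)
qed

lemma q_eq_0_iff [simp]: "q v = 0 \<longleftrightarrow> v = 0"
  using anisotropic q_scale[of 0 v] by (auto simp: anisotropic_def)

lemma f_nondegenerate: "u = v" if "\<And>w. f u w = f v w"
proof -
  have "2 * q (u - v) = 0"
    using that[of "u - v"] by (simp add: f_diff_left flip: f_self)
  then show ?thesis
    using two_nonzero by simp
qed

section \<open>The action of \<open>L\<close> on \<open>X\<close>\<close>

lemma act_act_sigma: "act (act a v) (sigma v) = scaleX (q v) a"
proof (cases "v = 0")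
  case False
  then have "scaleX (inverse (q v)) (act (act a v) (sigma v)) = a"
    using A3[OF False, of a] by (simp add: qinv_def act_scale_right)
  then have "scaleX (q v) (scaleX (inverse (q v)) (act (act a v) (sigma v))) = scaleX (q v) a"
    by simp
  then show ?thesis
    using False by simp
qed (simp add: qsigma_def)

text \<open>Elements orthogonal to \<open>e\<close>, in particular every \<open>\<pi> a\<close>, act on \<open>X\<close> with a scalar square.\<close>

lemma act_act_trace_zero: "act (act a v) v = - scaleX (q v) a" if "f v e = 0"
proof -
  have "sigma v = - v"
    using that by (simp add: qsigma_def f_commute)
  then show ?thesis
    using act_act_sigma[of a v] by (simp add: act_minus_right minus_equation_iff)
qed

text \<open>The action has no zero divisors, because \<open>q\<close> is anisotropic.\<close>

lemma act_cancel: "u = v" if "act a u = act a v" and "a \<noteq> 0"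
proof -
  have "scaleX (q (u - v)) a = 0"
    using that(1) act_act_sigma[of a "u - v"] by (simp add: act_diff_right)
  then show ?thesis
    using that(2) by simp
qed

section \<open>The form \<open>g\<close> and the map \<open>h\<close>\<close>

lemma f_h_e: "f (h a b) e = 2 * g a b"
  using two_nonzero by (simp add: g_def)

lemma h_swap: "h b a = h a b - scaleL (2 * g a b) e"
  using B2[of a b e] by (simp add: A2 f_h_e)

lemma f_e_e: "f e e = 2"
  by (simp add: f_self q_one)

lemma g_skew: "g b a = - g a b"
proof -
  have "2 * g b a = f (h a b - scaleL (2 * g a b) e) e"
    by (simp only: f_h_e flip: h_swap)
  also have "\<dots> = 2 * - g a b"
    by (simp add: f_diff_left f_scale_left f_e_e f_h_e)
  finally show ?thesis
    using mult_left_cancel[OF two_nonzero] by blast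
qed

lemma f_h: "f (h a b) v = 2 * g (act a v) b"
  by (simp add: B3 flip: f_h_e)

lemma g_add_left: "g (a + b) c = g a c + g b c"
  and g_add_right: "g a (b + c) = g a b + g a c"
  and g_scale_left: "g (scaleX r a) c = r * g a c"
  and g_scale_right: "g a (scaleX r c) = r * g a c"
  by (simp_all add: g_def bilinear_simps algebra_simps)

lemma hsym_commute: "hsym a b = hsym b a"
  by (simp add: hsym_def add.commute)

lemma hsym_alt: "hsym a b = h a b + h a b - scaleL (2 * g a b) e"
  using h_swap[of b a] by (simp add: hsym_def)

lemma f_hsym_e: "f (hsym a b) e = 0"
  by (simp add: hsym_alt bilinear_simps f_diff_left f_h_e f_e_e)

lemma h_self: "h a a = scaleL 2 (\<pi> a)"
  using two_nonzero by (simp add: C A2)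

lemma hsym_self: "hsym a a = scaleL 4 (\<pi> a)"
  by (simp add: hsym_def h_self flip: L.scale_left_distrib)

lemma f_pi_e: "f (\<pi> a) e = 0"
proof -
  have "4 * f (\<pi> a) e = 0"
    using f_hsym_e[of a a] by (simp add: hsym_self f_scale_left)
  then show ?thesis
    using four_nonzero by simp
qed

lemma g_act_right: "g w (act x u) = - (1/2) * f (h x w) u"
  using two_nonzero g_skew[of "act x u" w] by (simp add: f_h)

lemma g_act_hsym: "g w (act x (hsym y z)) = - (1/4) * f (hsym w x) (hsym y z)"
proof -
  have "f (hsym x w) (hsym y z) = 2 * f (h x w) (hsym y z)"
    using f_hsym_e[of y z] f_commute[of e]
    by (simp add: hsym_alt[of x w] f_diff_left bilinear_simps)
  then show ?thesis
    using two_nonzero four_nonzero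
    by (simp add: g_act_right hsym_commute[of w x] field_simps)
qed

section \<open>The map \<open>\<theta>\<close>\<close>

lemma f_theta_skew: "f (\<theta> a u) v = - f u (\<theta> a v)"
proof -
  have *: "f (\<theta> a u) v = g (act a v) (act a u)" for u v
    using two_nonzero by (simp add: C f_scale_left f_h)
  show ?thesis
    using *[of u v] *[of v u] g_skew[of "act a v" "act a u"] f_commute[of u] by simp
qed

text \<open>By (D1), \<open>x \<theta>(x, \<pi>(x)) = (x \<pi>(x)) \<pi>(x)\<close>, and \<open>\<pi>(x)\<close> has trace zero; then \<open>x\<close> is cancelled.\<close>

lemma theta_pi: "\<theta> x (\<pi> x) = - scaleL (q (\<pi> x)) e"
proof (cases "x = 0")
  case False
  have "act x (\<theta> x (\<pi> x)) = act x (- scaleL (q (\<pi> x)) e)"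
    using D1[of x "\<pi> x"] act_act_trace_zero[OF f_pi_e]
    by (simp add: act_minus_right act_scale_right A2)
  then show ?thesis
    using False by (rule act_cancel)
qed (simp add: C)

text \<open>The key identity: test against an arbitrary \<open>v\<close>, move \<open>v\<close> through (D1), and use that
  \<open>\<theta>(x, _)\<close> is skew for \<open>f\<close>.\<close>

lemma h_act_pi: "h (act x (\<pi> x)) y = - \<theta> x (h x y)"
proof (rule f_nondegenerate)
  fix v
  have "f (h (act x (\<pi> x)) y) v = 2 * g (act x (\<theta> x v)) y"
    by (simp add: f_h D1[of x v])
  also have "\<dots> = f (h x y) (\<theta> x v)"
    by (simp add: f_h)
  also have "\<dots> = f (- \<theta> x (h x y)) v"
    by (simp add: f_theta_skew f_minus_left)
  finally show "f (h (act x (\<pi> x)) y) v = f (- \<theta> x (h x y)) v" .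
qed

lemma h_self_act_pi: "h x (act x (\<pi> x)) = - scaleL (2 * q (\<pi> x)) e"
proof -
  have "h x (act x (\<pi> x)) = scaleL 2 (\<theta> x (\<pi> x))"
    using two_nonzero by (simp add: C)
  then show ?thesis
    by (simp add: theta_pi)
qed

lemma g_self_act_pi: "g x (act x (\<pi> x)) = - 2 * q (\<pi> x)"
  using two_nonzero by (simp add: g_def h_self_act_pi f_minus_left f_scale_left f_e_e)

lemma hsym_self_act_pi: "hsym x (act x (\<pi> x)) = 0"
  unfolding hsym_alt h_self_act_pi g_self_act_pi
  by (simp add: algebra_simps flip: L.scale_left_distrib)

lemma pi_act_pi: "\<pi> (act x (\<pi> x)) = scaleL (q (\<pi> x)) (\<pi> x)"
proof -
  have "\<pi> (act x (\<pi> x)) = scaleL (1/2) (- \<theta> x (- scaleL (2 * q (\<pi> x)) e))"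
    by (simp add: C[of "act x (\<pi> x)"] A2 h_act_pi h_self_act_pi)
  also have "\<dots> = scaleL (q (\<pi> x)) (\<pi> x)"
    using two_nonzero by (simp add: C h_minus_right act_minus_right bilinear_simps)
  finally show ?thesis .
qed

section \<open>The triple product\<close>

lemma hsym_add_left: "hsym (a + b) c = hsym a c + hsym b c"
  and hsym_add_right: "hsym a (b + c) = hsym a b + hsym a c"
  and hsym_scale_left: "hsym (scaleX r a) c = scaleL r (hsym a c)"
  and hsym_scale_right: "hsym a (scaleX r c) = scaleL r (hsym a c)"
  by (simp_all add: hsym_def bilinear_simps L.scale_right_distrib algebra_simps)

lemma pi_scale: "\<pi> (scaleX c x) = scaleL (c\<^sup>2) (\<pi> x)"
  by (simp add: C A2 bilinear_simps power2_eq_square mult.commute)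

lemma pi_nonzero: "\<pi> x \<noteq> 0" if "x \<noteq> 0"
proof
  assume "\<pi> x = 0"
  then have "\<pi> x = scaleL 0 e"
    by simp
  then have "\<pi> x \<in> range (\<lambda>c. scaleL c e)"
    by (rule range_eqI)
  then show False
    using D2 that by blast
qed

lemma tp_swap_12: "tp x y z = tp y x z" and tp_swap_23: "tp x y z = tp x z y"
  by (simp_all add: tp_def hsym_commute ac_simps)

lemma tp_swap_13: "tp x y z = tp z y x"
  by (metis tp_swap_12 tp_swap_23)

lemma tp_add_left: "tp (x + x') y z = tp x y z + tp x' y z"
  by (simp add: tp_def hsym_add_left act_add_left act_add_right X.scale_right_distrib ac_simps)

lemma tp_scale_left: "tp (scaleX c x) y z = scaleX c (tp x y z)"
  by (simp add: tp_def hsym_scale_left act_scale_left act_scale_right X.scale_right_distrib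
      mult.commute)

lemma tp_linear:
  "Vector_Spaces.linear scaleX scaleX (\<lambda>v. tp v y z)"
  "Vector_Spaces.linear scaleX scaleX (\<lambda>v. tp y v z)"
  "Vector_Spaces.linear scaleX scaleX (\<lambda>v. tp y z v)"
proof -
  show "Vector_Spaces.linear scaleX scaleX (\<lambda>v. tp v y z)" for y z
    by (simp add: Vector_Spaces.linear_iff X.vector_space_axioms tp_add_left tp_scale_left)
  then show "Vector_Spaces.linear scaleX scaleX (\<lambda>v. tp y v z)"
    "Vector_Spaces.linear scaleX scaleX (\<lambda>v. tp y z v)"
    by (simp only: tp_swap_12[of y], simp only: tp_swap_13[of y])
qed

lemma tp_symmetric_multilinear:
  "symmetric_multilinear 3 scaleX scaleX (\<lambda>x. tp (x 0) (x 1) (x 2))"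
proof (rule symmetric_multilinearI)
  fix i :: nat and x :: "nat \<Rightarrow> 'x"
  assume "i < 3"
  then consider "i = 0" | "i = 1" | "i = 2"
    by linarith
  then show "Vector_Spaces.linear scaleX scaleX
      (\<lambda>v. tp ((x(i := v)) 0) ((x(i := v)) 1) ((x(i := v)) 2))"
    by cases (simp_all add: tp_linear)
next
  fix i j :: nat and x :: "nat \<Rightarrow> 'x"
  assume "i < 3" "j < 3" "i \<noteq> j"
  then have "i = 0 \<and> j = 1 \<or> i = 1 \<and> j = 0 \<or> i = 0 \<and> j = 2 \<or> i = 2 \<and> j = 0
      \<or> i = 1 \<and> j = 2 \<or> i = 2 \<and> j = 1"
    by linarith
  then show "tp ((x \<circ> Transposition.transpose i j) 0) ((x \<circ> Transposition.transpose i j) 1)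
      ((x \<circ> Transposition.transpose i j) 2) = tp (x 0) (x 1) (x 2)"
    by (elim disjE conjE)
      (simp_all add: tp_swap_12[of "x (Suc 0)" "x 0"] tp_swap_13[of "x 2" "x (Suc 0)" "x 0"]
        tp_swap_23[of "x 0" "x 2" "x (Suc 0)"])
qed simp

lemma tp_self: "tp x x x = scaleX 6 (act x (\<pi> x))"
proof -
  have "tp x x x = scaleX (1/2 * (4 + 4 + 4)) (act x (\<pi> x))"
    by (simp only: tp_def hsym_self act_scale_right X.scale_scale flip: X.scale_left_distrib)
  also have "1/2 * (4 + 4 + 4) = (6::'k)"
    using two_nonzero by (simp add: field_simps)
  finally show ?thesis .
qed

text \<open>Written this way, the quartic form is visibly symmetric in all four arguments: the sum runs
  over the three ways of pairing them.\<close>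

lemma g_tp:
  "g w (tp x y z) = - (1/8) * (f (hsym w x) (hsym y z) + f (hsym w y) (hsym x z)
     + f (hsym w z) (hsym x y))"
  using two_nonzero
  by (simp add: tp_def g_scale_right g_add_right g_act_hsym field_simps)

lemma g_tp_self: "g x (tp x x x) = - 12 * q (\<pi> x)"
  by (simp add: tp_self g_scale_right g_self_act_pi)

text \<open>The defining identity of a Freudenthal triple system, divided by 6: \<open>x x x\<close> is \<open>6 x \<pi>(x)\<close>. The
  terms \<open>z h(x, y)\<close> and \<open>x h(z, y)\<close> with \<open>z = x \<pi>(x)\<close> cancel by (D1) and \<open>h_act_pi\<close>.\<close>

lemma tp_act_pi:
  "tp (act x (\<pi> x)) x y = scaleX (g y x) (act x (\<pi> x)) + scaleX (g y (act x (\<pi> x))) x"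
proof -
  let ?z = "act x (\<pi> x)"
  have "act ?z (h x y) = - act x (h ?z y)"
    using D1[of x "h x y"] by (simp add: h_act_pi act_minus_right)
  moreover have "hsym ?z x = 0"
    by (simp add: hsym_commute[of _ x] hsym_self_act_pi)
  ultimately have "act ?z (hsym x y) + act x (hsym ?z y) + act y (hsym ?z x)
      = scaleX (2 * g y x) ?z + scaleX (2 * g y ?z) x"
    by (simp add: hsym_alt[of _ y] act_add_right act_diff_right act_scale_right A2
        g_skew[of y] algebra_simps)
  then show ?thesis
    using two_nonzero by (simp add: tp_def X.scale_right_distrib)
qed

lemma tp_tp_self:
  "tp (tp x x x) x y = scaleX (g y x) (tp x x x) + scaleX (g y (tp x x x)) x"
  by (simp add: tp_self tp_scale_left tp_act_pi g_scale_right X.scale_right_distrib mult.commute)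

lemma g_tp_commute: "g w (tp x y z) = g x (tp w y z)"
  by (simp add: g_tp hsym_commute f_commute add.commute)

lemma g_tp_linear:
  "Vector_Spaces.linear scaleX (*) (\<lambda>v. g v (tp x y z))"
  "Vector_Spaces.linear scaleX (*) (\<lambda>v. g x (tp v y z))"
  "Vector_Spaces.linear scaleX (*) (\<lambda>v. g x (tp y v z))"
  "Vector_Spaces.linear scaleX (*) (\<lambda>v. g x (tp y z v))"
proof -
  have "vector_space ((*) :: 'k \<Rightarrow> 'k \<Rightarrow> 'k)"
    by unfold_locales (simp_all add: algebra_simps)
  then show *: "Vector_Spaces.linear scaleX (*) (\<lambda>v. g v (tp x y z))" for x y z
    by (simp add: Vector_Spaces.linear_iff X.vector_space_axioms g_add_left g_scale_left)
  show **: "Vector_Spaces.linear scaleX (*) (\<lambda>v. g x (tp v y z))" for x y z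
    using * by (simp only: g_tp_commute[of x])
  show "Vector_Spaces.linear scaleX (*) (\<lambda>v. g x (tp y v z))"
    "Vector_Spaces.linear scaleX (*) (\<lambda>v. g x (tp y z v))"
    using ** by (simp only: tp_swap_12[of y], simp only: tp_swap_13[of y])
qed

lemma g_tp_symmetric_multilinear:
  "symmetric_multilinear 4 scaleX (*) (\<lambda>x. g (x 0) (tp (x 1) (x 2) (x 3)))"
proof (rule symmetric_multilinearI)
  fix i :: nat and x :: "nat \<Rightarrow> 'x"
  assume "i < 4"
  then consider "i = 0" | "i = 1" | "i = 2" | "i = 3"
    by linarith
  then show "Vector_Spaces.linear scaleX (*)
      (\<lambda>v. g ((x(i := v)) 0) (tp ((x(i := v)) 1) ((x(i := v)) 2) ((x(i := v)) 3)))"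
    by cases (simp_all add: g_tp_linear)
next
  fix i j :: nat and x :: "nat \<Rightarrow> 'x"
  assume "i < 4" "j < 4" "i \<noteq> j"
  then have "i = 0 \<or> i = 1 \<or> i = 2 \<or> i = 3" "j = 0 \<or> j = 1 \<or> j = 2 \<or> j = 3" "i \<noteq> j"
    by linarith+
  then show "g ((x \<circ> Transposition.transpose i j) 0) (tp ((x \<circ> Transposition.transpose i j) 1)
      ((x \<circ> Transposition.transpose i j) 2) ((x \<circ> Transposition.transpose i j) 3))
      = g (x 0) (tp (x 1) (x 2) (x 3))"
    by (elim disjE) (simp_all add: transpose_def g_tp hsym_commute f_commute ac_simps)
qed simp

section \<open>The Freudenthal triple system\<close>

lemma freudenthal_triple_system_tp:
  assumes "CHAR('k) \<noteq> 3"
  shows "freudenthal_triple_system scaleX tp g"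
proof
  show "CHAR('k) \<noteq> 2" "CHAR('k) \<noteq> 3"
    by (fact char_not_2 assms)+
  show "bilinear_map scaleX scaleX (*) g"
    by (simp add: bilinear_map_def Vector_Spaces.linear_iff X.vector_space_axioms
        g_add_left g_add_right g_scale_left g_scale_right)
      (unfold_locales, simp_all add: algebra_simps)
  obtain x :: 'x where "x \<noteq> 0"
    using X_nonzero by blast
  moreover have "(12::'k) \<noteq> 0"
    using four_nonzero three_nonzero[OF assms] mult_eq_0_iff[of "3::'k" 4] by simp
  ultimately have "g x (tp x x x) \<noteq> 0"
    by (simp add: g_tp_self pi_nonzero)
  then show "\<exists>x y z w. g x (tp y z w) \<noteq> 0"
    by blast
qed (fact tp_symmetric_multilinear g_tp_symmetric_multilinear g_skew tp_tp_self)+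

text \<open>The core of the proof of simplicity. With \<open>p = \<pi>(x)\<close> and \<open>z = xp\<close>, the identity
  \<open>z x y = \<langle>y, x\<rangle> z + \<langle>y, z\<rangle> x\<close> puts a vector \<open>w = \<alpha> z + \<beta> x\<close> of the plane spanned by \<open>x\<close> and \<open>z\<close> into
  the ideal \<open>I\<close>. Also \<open>w w w\<close>, a nonzero multiple of \<open>wp\<close>, lies in \<open>I\<close>. Since \<open>p \<notin> K e\<close> and \<open>q\<close> is
  anisotropic, \<open>w\<close> and \<open>wp\<close> span the whole plane.\<close>

lemma mem_ideal:
  assumes I: "X.subspace I" and ideal: "\<And>u x y. u \<in> I \<Longrightarrow> tp u x y \<in> I"
    and six: "(6::'k) \<noteq> 0"
    and y: "y \<in> I" and nz: "g y x \<noteq> 0"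
  shows "x \<in> I"
proof -
  define p where "p = \<pi> x"
  define z where "z = act x p"
  define \<alpha> where "\<alpha> = g y x"
  define \<beta> where "\<beta> = g y z"
  define w where "w = scaleX \<alpha> z + scaleX \<beta> x"
  define r where "r = \<alpha>\<^sup>2 * q p + \<beta>\<^sup>2"
  have "tp z x y \<in> I"
    using ideal[OF y, of x z] by (simp add: tp_swap_13)
  then have "w \<in> I"
    by (simp add: w_def \<alpha>_def \<beta>_def z_def p_def tp_act_pi)
  have "x \<noteq> 0"
    using nz g_scale_right[of y 0 0] by auto
  \<comment> \<open>\<open>r\<close> is both the value of \<open>q\<close> at \<open>\<alpha> p + \<beta> e\<close> and, up to sign, the determinant of \<open>w\<close> and \<open>wp\<close>
    with respect to \<open>x\<close> and \<open>z\<close>.\<close>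
  have "r \<noteq> 0"
  proof
    assume "r = 0"
    have "q (scaleL \<alpha> p + scaleL \<beta> e) = q (scaleL \<alpha> p) + q (scaleL \<beta> e)
        + f (scaleL \<alpha> p) (scaleL \<beta> e)"
      by (simp add: polar_def)
    also have "\<dots> = r"
      by (simp add: r_def q_scale q_one f_scale_left f_scale_right f_pi_e p_def)
    finally have "scaleL \<alpha> p = scaleL (- \<beta>) e"
      using \<open>r = 0\<close> by (simp add: add_eq_0_iff2)
    then have "scaleL (inverse \<alpha>) (scaleL \<alpha> p) = scaleL (inverse \<alpha> * - \<beta>) e"
      by simp
    then have "\<pi> x = scaleL (inverse \<alpha> * - \<beta>) e"
      using nz by (simp add: \<alpha>_def p_def)
    then show False
      using D2 \<open>x \<noteq> 0\<close> by blast
  qed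
  have "hsym x z = 0" "hsym z x = 0"
    using hsym_self_act_pi[of x] by (simp_all add: z_def p_def hsym_commute)
  moreover have "hsym z z = scaleL (q p) (hsym x x)"
    by (simp add: hsym_self z_def p_def pi_act_pi mult.commute)
  ultimately have "hsym w w = scaleL r (hsym x x)"
    by (simp add: w_def r_def hsym_add_left hsym_add_right hsym_scale_left hsym_scale_right
        power2_eq_square L.scale_left_distrib mult.assoc)
  then have "scaleL 4 (\<pi> w) = scaleL 4 (scaleL r p)"
    by (simp add: hsym_self p_def mult.commute)
  then have "\<pi> w = scaleL r p"
    using four_nonzero by (simp only: L.scale_cancel_left simp_thms)
  then have "tp w w w = scaleX (6 * r) (act w p)"
    by (simp add: tp_self act_scale_right)
  then have "scaleX (inverse (6 * r)) (scaleX (6 * r) (act w p)) \<in> I"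
    using ideal[OF \<open>w \<in> I\<close>] I X.subspace_scale by metis
  then have "act w p \<in> I"
    using six \<open>r \<noteq> 0\<close> by simp
  moreover have "act w p = scaleX \<beta> z - scaleX (\<alpha> * q p) x"
    using act_act_trace_zero[OF f_pi_e, of x x]
    by (simp add: w_def z_def p_def act_add_left act_scale_left)
  ultimately have "scaleX \<beta> w - scaleX \<alpha> (scaleX \<beta> z - scaleX (\<alpha> * q p) x) \<in> I"
    using I \<open>w \<in> I\<close> by (metis X.subspace_diff X.subspace_scale)
  also have "scaleX \<beta> w - scaleX \<alpha> (scaleX \<beta> z - scaleX (\<alpha> * q p) x) = scaleX r x"
    by (simp add: w_def r_def X.scale_right_distrib X.scale_right_diff_distrib
        X.scale_left_distrib power2_eq_square mult.commute mult.left_commute)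
  finally have "scaleX (inverse r) (scaleX r x) \<in> I"
    using I X.subspace_scale by blast
  then show "x \<in> I"
    using \<open>r \<noteq> 0\<close> by simp
qed

lemma simple_tp:
  assumes "CHAR('k) \<noteq> 3"
  shows "freudenthal_triple_system.simple scaleX tp"
proof -
  interpret F: freudenthal_triple_system scaleX tp g
    using assms by (rule freudenthal_triple_system_tp)
  have six: "(6::'k) \<noteq> 0"
    using two_nonzero three_nonzero[OF assms] mult_eq_0_iff[of "3::'k" 2] by simp
  then have twelve: "(12::'k) \<noteq> 0"
    using two_nonzero mult_eq_0_iff[of "6::'k" 2] by simp
  have False if I: "X.subspace I" "I \<noteq> {0}" "I \<noteq> UNIV" and ideal: "\<And>u x y. u \<in> I \<Longrightarrow> tp u x y \<in> I"
    for I
  proof -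
    have "0 \<in> I"
      using I(1) by (rule X.subspace_0)
    then obtain u where u: "u \<in> I" "u \<noteq> 0"
      using I(2) by blast
    obtain v where v: "v \<notin> I"
      using I(3) by blast
    have outside: "g u x = 0" if "x \<notin> I" for x
      using mem_ideal[OF I(1) ideal six u(1)] that by blast
    \<comment> \<open>All vectors outside \<open>I\<close> are orthogonal to \<open>u\<close>. They generate \<open>X\<close>, so \<open>u\<close> is orthogonal even
      to \<open>u u u\<close>, which contradicts \<open>\<langle>u, u u u\<rangle> = - 12 q(\<pi>(u)) \<noteq> 0\<close>.\<close>
    let ?x = "tp u u u"
    have "?x \<in> I"
      using ideal u(1) by blast
    then have "v + ?x \<notin> I"
      using v I(1) X.subspace_diff[of I "v + ?x" ?x] by auto
    then have "g u ?x = 0"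
      using outside[of "v + ?x"] outside[OF v] by (simp add: g_add_right)
    then show False
      using twelve pi_nonzero[OF u(2)] by (simp add: g_tp_self)
  qed
  then show ?thesis
    unfolding F.simple_def by blast
qed

text \<open>If \<open>u\<close> were strictly regular, then \<open>u u u = 6 u \<pi>(u)\<close> would be a multiple of \<open>u\<close>; after cancelling
  \<open>u\<close>, \<open>\<pi>(u)\<close> would lie in \<open>K e\<close>, contrary to (D2).\<close>

lemma not_reduced_tp:
  assumes "CHAR('k) \<noteq> 3"
  shows "\<not> freudenthal_triple_system.reduced scaleX tp"
proof -
  interpret F: freudenthal_triple_system scaleX tp g
    using assms by (rule freudenthal_triple_system_tp)
  have six: "(6::'k) \<noteq> 0"
    using two_nonzero three_nonzero[OF assms] mult_eq_0_iff[of "3::'k" 2] by simp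
  have False if "F.strictly_regular u" for u
  proof -
    have "u \<noteq> 0" and "tp u u u \<in> range (\<lambda>c. scaleX c u)"
      using that by (auto simp: F.strictly_regular_def)
    then obtain c where "scaleX 6 (act u (\<pi> u)) = scaleX c u"
      by (auto simp: tp_self)
    also have "\<dots> = scaleX 6 (act u (scaleL (c / 6) e))"
      using six by (simp add: act_scale_right A2)
    finally have "act u (\<pi> u) = act u (scaleL (c / 6) e)"
      using six by simp
    then have "\<pi> u = scaleL (c / 6) e"
      using \<open>u \<noteq> 0\<close> by (rule act_cancel)
    then show False
      using D2 \<open>u \<noteq> 0\<close> by blast
  qed
  then show ?thesis
    unfolding F.reduced_def by blast
qed

section \<open>Linearizations\<close>

lemma linearization_cubic:
  assumes "CHAR('k) \<noteq> 3"
  shows "is_linearization 3 scaleX scaleX (\<lambda>x. act x (\<pi> x)) (\<lambda>x. tp (x 0) (x 1) (x 2))"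
proof (rule is_linearizationI)
  show "homogeneous_map 3 scaleX scaleX (\<lambda>x. act x (\<pi> x))"
    by (simp add: homogeneous_map_def pi_scale act_scale_left act_scale_right
        power2_eq_square power3_eq_cube mult.assoc)
  show "tp v v v = scaleX (of_nat (fact 3)) (act v (\<pi> v))" for v
    by (simp add: tp_self fact_numeral)
qed (use two_nonzero three_nonzero[OF assms] X.vector_space_axioms tp_symmetric_multilinear in auto)

lemma linearization_quartic:
  assumes "CHAR('k) \<noteq> 3"
  shows "is_linearization 4 scaleX (*)
    (\<lambda>x. - (1/2) * q (\<pi> x)) (\<lambda>x. g (x 0) (tp (x 1) (x 2) (x 3)))"
proof (rule is_linearizationI)
  show "vector_space ((*) :: 'k \<Rightarrow> 'k \<Rightarrow> 'k)"
    by unfold_locales (simp_all add: algebra_simps)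
  show "homogeneous_map 4 scaleX (*) (\<lambda>x. - (1/2) * q (\<pi> x))"
    by (simp add: homogeneous_map_def pi_scale q_scale flip: power_mult)
  show "g v (tp v v v) = of_nat (fact 4) * (- (1/2) * q (\<pi> v))" for v
    using two_nonzero by (simp add: g_tp_self fact_numeral field_simps)
qed (use two_nonzero three_nonzero[OF assms] g_tp_symmetric_multilinear in auto)

end

theorem theorem4p1:
  fixes scaleL :: "'k::field \<Rightarrow> 'l::ab_group_add \<Rightarrow> 'l"
    and scaleX :: "'k \<Rightarrow> 'x::ab_group_add \<Rightarrow> 'x"
    and q :: "'l \<Rightarrow> 'k" and e :: 'l
    and act :: "'x \<Rightarrow> 'l \<Rightarrow> 'x" and h :: "'x \<Rightarrow> 'x \<Rightarrow> 'l" and \<theta> :: "'x \<Rightarrow> 'l \<Rightarrow> 'l"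
  assumes "quadrangular_algebra scaleL scaleX q e act h \<theta>"
    and "CHAR('k) \<noteq> 2" and "CHAR('k) \<noteq> 3"
  shows "let \<pi> = (\<lambda>a. \<theta> a e);
             g = (\<lambda>a b. 1/2 * polar q (h a b) e);
             tp = (\<lambda>x y z. scaleX (1/2)
                (act x (h y z + h z y) + act y (h x z + h z x) + act z (h x y + h y x)))
         in freudenthal_triple_system scaleX tp g \<and>
            freudenthal_triple_system.simple scaleX tp \<and>
            \<not> freudenthal_triple_system.reduced scaleX tp \<and>
            is_linearization 3 scaleX scaleX
              (\<lambda>x. act x (\<pi> x)) (\<lambda>x. tp (x 0) (x 1) (x 2)) \<and>
            is_linearization 4 scaleX (*)
              (\<lambda>x. - (1/2) * q (\<pi> x)) (\<lambda>x. g (x 0) (tp (x 1) (x 2) (x 3))) \<and>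
            (\<forall>x. tp x x x = scaleX 6 (act x (\<pi> x))) \<and>
            (\<forall>x. g x (tp x x x) = - 12 * q (\<pi> x))"
proof -
  interpret quadrangular_algebra scaleL scaleX q e act h \<theta>
    by fact
  have tp: "(\<lambda>x y z. scaleX (1/2)
      (act x (h y z + h z y) + act y (h x z + h z x) + act z (h x y + h y x))) = tp"
    by (simp add: fun_eq_iff tp_def hsym_def)
  have g: "(\<lambda>a b. 1/2 * polar q (h a b) e) = g"
    by (simp add: fun_eq_iff g_def)
  show ?thesis
    unfolding Let_def tp g
    using freudenthal_triple_system_tp[OF assms(3)] simple_tp[OF assms(3)]
      not_reduced_tp[OF assms(3)] linearization_cubic[OF assms(3)]
      linearization_quartic[OF assms(3)] tp_self g_tp_self
    by blast
qed

end
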